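(* Let $\mathfrak{A}$ be any model of Presburger Arithmetic $\mathbf{PrA}$ that is one-dimensionally interpreted in the model $(\mathbb{N},+)$. Then: (a) $\mathfrak{A}$ is isomorphic to $(\mathbb{N},+)$; (b) the isomorphism between $\mathfrak{A}$ and $(\mathbb{N},+)$ is definable in $(\mathbb{N},+)$.
   Context: $\mathbb{N}$ includes $0$. Presburger Arithmetic $\mathbf{PrA}$ is the elementary (first-order) theory of the model $(\mathbb{N},+)$, i.e. the set of all first-order sentences true in $(\mathbb{N},+)$. An $m$-dimensional interpretation $\iota$ ($m\ge 1$) of a first-order language $\mathcal{K}$ in a model $\mathfrak{M}$ consists of (parameter-free) first-order formulas of the language of $\mathfrak{M}$: $D_\iota(\overline{y})$ defining a set $\mathbf{D}_\iota\subseteq\mathfrak{M}^m$ (the domain); $P_\iota(\overline{x}_1,\ldots,\overline{x}_n)$ for each predicate symbol $P(x_1,\ldots,x_n)$ of $\mathcal{K}$, including equality; $f_\iota(\overline{x}_1,\ldots,\overline{x}_n,\overline{y})$ for each function symbol $f(x_1,\ldots,x_n)$ of $\mathcal{K}$. All vectors of variables have length $m$, and each $f_\iota$ defines the graph of a function modulo the interpretation of equality. This yields a $\mathcal{K}$-structure (the internal model) with domain $\mathbf{D}_\iota/{\sim_\iota}$, where $\sim_\iota$ is the equivalence relation given by the formula $=_\iota(\overline{x}_1,\overline{x}_2)$. A model is $m$-dimensionally interpreted in $\mathfrak{M}$ if it is the internal model of an $m$-dimensional interpretation in $\mathfrak{M}$; one-dimensional means $m=1$. The isomorphism being definable means that there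 is a first-order formula $F(\overline{x},y)$ of the language of $(\mathbb{N},+)$ (with $\overline{x}$ of length $m$) which defines an isomorphism from the internal model $\mathfrak{A}$ (elements represented by tuples in $\mathbf{D}_\iota$) to $(\mathbb{N},+)$. *)

theory Defs
  imports Main
begin

section \<open>First-order logic with equality\<close>

text \<open>A language is given by partial arity functions; the symbols of the language are those with a
  defined arity. Equality is a logical symbol and is always available.\<close>

record ('f, 'p) lang =
  fun_arity :: "'f \<Rightarrow> nat option"
  pred_arity :: "'p \<Rightarrow> nat option"

datatype 'f tm = Var nat | App 'f "'f tm list"

datatype ('f, 'p) fm =
    Eq "'f tm" "'f tm"
  | Pred 'p "'f tm list"
  | Neg "('f, 'p) fm"
  | Conj "('f, 'p) fm" "('f, 'p) fm"
  | Exists nat "('f, 'p) fm"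

fun wf_tm :: "('f, 'p) lang \<Rightarrow> 'f tm \<Rightarrow> bool" where
  "wf_tm L (Var x) \<longleftrightarrow> True"
| "wf_tm L (App f ts) \<longleftrightarrow> fun_arity L f = Some (length ts) \<and> (\<forall>t\<in>set ts. wf_tm L t)"

fun wf_fm :: "('f, 'p) lang \<Rightarrow> ('f, 'p) fm \<Rightarrow> bool" where
  "wf_fm L (Eq s t) \<longleftrightarrow> wf_tm L s \<and> wf_tm L t"
| "wf_fm L (Pred p ts) \<longleftrightarrow> pred_arity L p = Some (length ts) \<and> (\<forall>t\<in>set ts. wf_tm L t)"
| "wf_fm L (Neg \<phi>) \<longleftrightarrow> wf_fm L \<phi>"
| "wf_fm L (Conj \<phi> \<psi>) \<longleftrightarrow> wf_fm L \<phi> \<and> wf_fm L \<psi>"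
| "wf_fm L (Exists x \<phi>) \<longleftrightarrow> wf_fm L \<phi>"

fun fv_tm :: "'f tm \<Rightarrow> nat set" where
  "fv_tm (Var x) = {x}"
| "fv_tm (App f ts) = (\<Union>t\<in>set ts. fv_tm t)"

fun fv :: "('f, 'p) fm \<Rightarrow> nat set" where
  "fv (Eq s t) = fv_tm s \<union> fv_tm t"
| "fv (Pred p ts) = (\<Union>t\<in>set ts. fv_tm t)"
| "fv (Neg \<phi>) = fv \<phi>"
| "fv (Conj \<phi> \<psi>) = fv \<phi> \<union> fv \<psi>"
| "fv (Exists x \<phi>) = fv \<phi> - {x}"

definition formula_in :: "('f, 'p) lang \<Rightarrow> nat \<Rightarrow> ('f, 'p) fm \<Rightarrow> bool" where
  "formula_in L n \<phi> \<longleftrightarrow> wf_fm L \<phi> \<and> fv \<phi> \<subseteq> {..<n}"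

abbreviation sentence :: "('f, 'p) lang \<Rightarrow> ('f, 'p) fm \<Rightarrow> bool" where
  "sentence L \<phi> \<equiv> formula_in L 0 \<phi>"

record ('a, 'f, 'p) struct =
  dom :: "'a set"
  fun_of :: "'f \<Rightarrow> 'a list \<Rightarrow> 'a"
  pred_of :: "'p \<Rightarrow> 'a list \<Rightarrow> bool"

fun val :: "('a, 'f, 'p) struct \<Rightarrow> (nat \<Rightarrow> 'a) \<Rightarrow> 'f tm \<Rightarrow> 'a" where
  "val M e (Var x) = e x"
| "val M e (App f ts) = fun_of M f (map (val M e) ts)"

fun sat :: "('a, 'f, 'p) struct \<Rightarrow> (nat \<Rightarrow> 'a) \<Rightarrow> ('f, 'p) fm \<Rightarrow> bool" where
  "sat M e (Eq s t) \<longleftrightarrow> val M e s = val M e t"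
| "sat M e (Pred p ts) \<longleftrightarrow> pred_of M p (map (val M e) ts)"
| "sat M e (Neg \<phi>) \<longleftrightarrow> \<not> sat M e \<phi>"
| "sat M e (Conj \<phi> \<psi>) \<longleftrightarrow> sat M e \<phi> \<and> sat M e \<psi>"
| "sat M e (Exists x \<phi>) \<longleftrightarrow> (\<exists>a\<in>dom M. sat M (e(x := a)) \<phi>)"

definition holds :: "('a, 'f, 'p) struct \<Rightarrow> ('f, 'p) fm \<Rightarrow> bool" where
  "holds M \<phi> \<longleftrightarrow> (\<forall>e. range e \<subseteq> dom M \<longrightarrow> sat M e \<phi>)"

definition is_model :: "('a, 'f, 'p) struct \<Rightarrow> ('f, 'p) fm set \<Rightarrow> bool" where
  "is_model M T \<longleftrightarrow> (\<forall>\<phi>\<in>T. holds M \<phi>)"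

definition theory_of :: "('f, 'p) lang \<Rightarrow> ('a, 'f, 'p) struct \<Rightarrow> ('f, 'p) fm set" where
  "theory_of L M = {\<phi>. sentence L \<phi> \<and> holds M \<phi>}"

text \<open>Truth at a tuple: variable \<open>i\<close> takes the value \<open>xs ! i\<close>. This is only used for formulas whose
  free variables lie below \<open>length xs\<close>, so out-of-range values of \<open>nth\<close> are irrelevant.\<close>

definition sat_at :: "('a, 'f, 'p) struct \<Rightarrow> 'a list \<Rightarrow> ('f, 'p) fm \<Rightarrow> bool" where
  "sat_at M xs \<phi> \<longleftrightarrow> sat M (nth xs) \<phi>"

definition isomorphism ::
  "('f, 'p) lang \<Rightarrow> ('a, 'f, 'p) struct \<Rightarrow> ('b, 'f, 'p) struct \<Rightarrow> ('a \<Rightarrow> 'b) \<Rightarrow> bool" where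
  "isomorphism L M N h \<longleftrightarrow>
     bij_betw h (dom M) (dom N) \<and>
     (\<forall>f n xs. fun_arity L f = Some n \<longrightarrow> length xs = n \<longrightarrow> set xs \<subseteq> dom M \<longrightarrow>
        h (fun_of M f xs) = fun_of N f (map h xs)) \<and>
     (\<forall>p n xs. pred_arity L p = Some n \<longrightarrow> length xs = n \<longrightarrow> set xs \<subseteq> dom M \<longrightarrow>
        (pred_of M p xs \<longleftrightarrow> pred_of N p (map h xs)))"

definition isomorphic ::
  "('f, 'p) lang \<Rightarrow> ('a, 'f, 'p) struct \<Rightarrow> ('b, 'f, 'p) struct \<Rightarrow> bool" where
  "isomorphic L M N \<longleftrightarrow> (\<exists>h. isomorphism L M N h)"

section \<open>Multi-dimensional interpretations\<close>

text \<open>The formulas translating the symbols of a language over \<open>'f\<close>, \<open>'p\<close> into formulas over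
  \<open>'g\<close>, \<open>'q\<close>. In dimension \<open>m\<close> the \<open>i\<close>-th vector argument of such a formula consists of the variables
  \<open>i * m, \<dots>, i * m + m - 1\<close>, so the formula is evaluated at the concatenation of its vector
  arguments; the last vector argument of \<open>fun_fm f\<close> is the value.\<close>

record ('f, 'p, 'g, 'q) interp =
  dom_fm :: "('g, 'q) fm"
  eq_fm :: "('g, 'q) fm"
  pred_fm :: "'p \<Rightarrow> ('g, 'q) fm"
  fun_fm :: "'f \<Rightarrow> ('g, 'q) fm"

definition int_dom ::
  "nat \<Rightarrow> ('a, 'g, 'q) struct \<Rightarrow> ('f, 'p, 'g, 'q) interp \<Rightarrow> 'a list set" where
  "int_dom m M \<iota> = {x. length x = m \<and> set x \<subseteq> dom M \<and> sat_at M x (dom_fm \<iota>)}"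

definition int_eq ::
  "nat \<Rightarrow> ('a, 'g, 'q) struct \<Rightarrow> ('f, 'p, 'g, 'q) interp \<Rightarrow> ('a list \<times> 'a list) set" where
  "int_eq m M \<iota> =
     {(x, y). x \<in> int_dom m M \<iota> \<and> y \<in> int_dom m M \<iota> \<and> sat_at M (x @ y) (eq_fm \<iota>)}"

text \<open>The non-emptiness condition makes the internal model a first-order structure. The last two
  conditions say that the formulas for predicate symbols respect the interpreted equality, and that
  the formulas for function symbols define graphs of functions modulo the interpreted equality.\<close>

definition interpretation_in ::
  "nat \<Rightarrow> ('f, 'p) lang \<Rightarrow> ('g, 'q) lang \<Rightarrow> ('a, 'g, 'q) struct \<Rightarrow>
     ('f, 'p, 'g, 'q) interp \<Rightarrow> bool" where
  "interpretation_in m K L M \<iota> \<longleftrightarrow>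
     1 \<le> m \<and>
     formula_in L m (dom_fm \<iota>) \<and>
     formula_in L (2 * m) (eq_fm \<iota>) \<and>
     (\<forall>p n. pred_arity K p = Some n \<longrightarrow> formula_in L (n * m) (pred_fm \<iota> p)) \<and>
     (\<forall>f n. fun_arity K f = Some n \<longrightarrow> formula_in L (Suc n * m) (fun_fm \<iota> f)) \<and>
     int_dom m M \<iota> \<noteq> {} \<and>
     equiv (int_dom m M \<iota>) (int_eq m M \<iota>) \<and>
     (\<forall>p n xs xs'. pred_arity K p = Some n \<longrightarrow> length xs = n \<longrightarrow>
        list_all2 (\<lambda>x x'. (x, x') \<in> int_eq m M \<iota>) xs xs' \<longrightarrow>
        (sat_at M (concat xs) (pred_fm \<iota> p) \<longleftrightarrow> sat_at M (concat xs') (pred_fm \<iota> p))) \<and>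
     (\<forall>f n xs. fun_arity K f = Some n \<longrightarrow> length xs = n \<longrightarrow> set xs \<subseteq> int_dom m M \<iota> \<longrightarrow>
        (\<exists>y\<in>int_dom m M \<iota>. sat_at M (concat xs @ y) (fun_fm \<iota> f))) \<and>
     (\<forall>f n xs xs'. fun_arity K f = Some n \<longrightarrow> length xs = n \<longrightarrow>
        list_all2 (\<lambda>x x'. (x, x') \<in> int_eq m M \<iota>) xs xs' \<longrightarrow>
        (\<forall>y\<in>int_dom m M \<iota>. \<forall>y'\<in>int_dom m M \<iota>.
           sat_at M (concat xs @ y) (fun_fm \<iota> f) \<longrightarrow>
           sat_at M (concat xs' @ y') (fun_fm \<iota> f) \<longrightarrow> (y, y') \<in> int_eq m M \<iota>))"

definition internal_model ::
  "nat \<Rightarrow> ('a, 'g, 'q) struct \<Rightarrow> ('f, 'p, 'g, 'q) interp \<Rightarrow> ('a list set, 'f, 'p) struct" where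
  "internal_model m M \<iota> =
     \<lparr>dom = int_dom m M \<iota> // int_eq m M \<iota>,
      fun_of = (\<lambda>f Xs. THE Y. Y \<in> int_dom m M \<iota> // int_eq m M \<iota> \<and>
        (\<exists>xs y. list_all2 (\<in>) xs Xs \<and> y \<in> Y \<and> sat_at M (concat xs @ y) (fun_fm \<iota> f))),
      pred_of = (\<lambda>p Xs. \<exists>xs. list_all2 (\<in>) xs Xs \<and> sat_at M (concat xs) (pred_fm \<iota> p))\<rparr>"

text \<open>A formula \<open>F(x, y)\<close> of the language of \<open>M\<close> defines an isomorphism from the internal model
  onto \<open>M\<close> itself: \<open>F\<close> defines the graph of an isomorphism, the elements of the internal model
  being given by arbitrary representatives.\<close>

definition defines_isomorphism ::
  "nat \<Rightarrow> ('f, 'p) lang \<Rightarrow> ('a, 'f, 'p) struct \<Rightarrow> ('f, 'p, 'f, 'p) interp \<Rightarrow>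
     ('f, 'p) fm \<Rightarrow> bool" where
  "defines_isomorphism m L M \<iota> F \<longleftrightarrow>
     formula_in L (m + 1) F \<and>
     (\<exists>h. isomorphism L (internal_model m M \<iota>) M h \<and>
        (\<forall>x y. length x = m \<longrightarrow> set x \<subseteq> dom M \<longrightarrow> y \<in> dom M \<longrightarrow>
           (sat_at M (x @ [y]) F \<longleftrightarrow>
              x \<in> int_dom m M \<iota> \<and> h (int_eq m M \<iota> `` {x}) = y)))"

section \<open>Presburger arithmetic\<close>

datatype add_sym = Plus

text \<open>The language has no predicate symbols besides equality: \<open>unit\<close> is only a type argument, its
  element having no arity.\<close>

definition add_lang :: "(add_sym, unit) lang" where
  "add_lang = \<lparr>fun_arity = (\<lambda>_. Some 2), pred_arity = (\<lambda>_. None)\<rparr>"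

definition nat_add :: "(nat, add_sym, unit) struct" where
  "nat_add = \<lparr>dom = UNIV, fun_of = (\<lambda>_ xs. xs ! 0 + xs ! 1), pred_of = (\<lambda>_ _. False)\<rparr>"

definition PrA :: "(add_sym, unit) fm set" where
  "PrA = theory_of add_lang nat_add"

end

theory Submission imports "HOL-Decision_Procs.Cooper" Defs begin

text \<open>By quantifier elimination, for every binary relation \<open>R\<close> definable in \<open>(\<nat>, +)\<close> there is a single
  shift \<open>N > 0\<close> such that the fibres \<open>{y. R x y}\<close> and their shifts by \<open>N\<close> differ at boundedly many
  places, uniformly in \<open>x\<close>. This is applied to the order of the internal model.

  The initial segments of the internal model, coded by least representatives, are eventually
  \<open>N\<close>-periodic sets of natural numbers, so they fall into finitely many classes up to finite
  differences. If the segment below some \<open>c\<close> were infinite, the segments below the multiples of \<open>c\<close>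
  would differ pairwise by infinite sets. Hence all initial segments are finite, and the number of
  elements below \<open>x\<close> is an isomorphism onto \<open>(\<nat>, +)\<close>. For a finite set \<open>X\<close> of natural numbers with shift
  \<open>Y = X + N\<close> one has \<open>\<Sum>(Y - X) = \<Sum>(X - Y) + N * card X\<close>; both differences have bounded size here, so
  the number of elements below \<open>x\<close> is a definable function of \<open>x\<close>.\<close>

section \<open>Definable relations\<close>

lemma finite_fv_tm: "finite (fv_tm t)"
  by (induction t) auto

lemma finite_fv: "finite (fv \<phi>)"
  by (induction \<phi>) (auto simp: finite_fv_tm)

lemma val_cong: "(\<And>i. i \<in> fv_tm t \<Longrightarrow> e i = e' i) \<Longrightarrow> val M e t = val M e' t"
proof (induction t)
  case (App f ts)
  then have "map (val M e) ts = map (val M e') ts"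
    by (auto intro!: map_cong)
  then show ?case
    by (simp del: map_eq_conv)
qed simp

lemma sat_cong: "(\<And>i. i \<in> fv \<phi> \<Longrightarrow> e i = e' i) \<Longrightarrow> sat M e \<phi> = sat M e' \<phi>"
proof (induction \<phi> arbitrary: e e')
  case (Eq s t)
  then show ?case
    using val_cong[of s e e' M] val_cong[of t e e' M] by auto
next
  case (Pred p ts)
  then have "map (val M e) ts = map (val M e') ts"
    by (auto intro!: map_cong val_cong)
  then show ?case
    by (simp del: map_eq_conv)
next
  case (Neg \<phi>)
  then show ?case
    by (metis fv.simps(3) sat.simps(3))
next
  case (Conj \<phi> \<psi>)
  have "sat M e \<phi> = sat M e' \<phi>" "sat M e \<psi> = sat M e' \<psi>"
    using Conj.prems by (intro Conj.IH; simp)+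
  then show ?case
    by simp
next
  case (Exists x \<phi>)
  have "sat M (e(x := a)) \<phi> = sat M (e'(x := a)) \<phi>" for a
    using Exists.prems by (intro Exists.IH) auto
  then show ?case
    by simp
qed

fun rename_tm :: "(nat \<Rightarrow> nat) \<Rightarrow> 'f tm \<Rightarrow> 'f tm" where
  "rename_tm f (Var x) = Var (f x)"
| "rename_tm f (App g ts) = App g (map (rename_tm f) ts)"

text \<open>Capture is avoided by choosing the new bound variable outside the image of all free
  variables of the body; such a variable exists because \<open>fv\<close> is finite.\<close>

fun rename :: "(nat \<Rightarrow> nat) \<Rightarrow> ('f, 'p) fm \<Rightarrow> ('f, 'p) fm" where
  "rename f (Eq s t) = Eq (rename_tm f s) (rename_tm f t)"
| "rename f (Pred p ts) = Pred p (map (rename_tm f) ts)"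
| "rename f (Neg \<phi>) = Neg (rename f \<phi>)"
| "rename f (Conj \<phi> \<psi>) = Conj (rename f \<phi>) (rename f \<psi>)"
| "rename f (Exists x \<phi>) =
    (let y = (SOME y. y \<notin> f ` fv \<phi>) in Exists y (rename (f(x := y)) \<phi>))"

lemma wf_rename_tm: "wf_tm L (rename_tm f t) = wf_tm L t"
  by (induction t) auto

lemma wf_rename: "wf_fm L (rename f \<phi>) = wf_fm L \<phi>"
  by (induction \<phi> arbitrary: f) (auto simp: wf_rename_tm Let_def)

lemma fv_rename_tm: "fv_tm (rename_tm f t) = f ` fv_tm t"
  by (induction t) auto

lemma fv_rename: "fv (rename f \<phi>) \<subseteq> f ` fv \<phi>"
proof (induction \<phi> arbitrary: f)
  case (Exists x \<phi>)
  define y where "y = (SOME y. y \<notin> f ` fv \<phi>)"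
  have "(f(x := y)) ` fv \<phi> \<subseteq> insert y (f ` (fv \<phi> - {x}))"
    by auto
  then have "fv (rename (f(x := y)) \<phi>) - {y} \<subseteq> f ` (fv \<phi> - {x})"
    using Exists.IH[of "f(x := y)"] by blast
  then show ?case
    by (simp add: Let_def flip: y_def)
next
  case (Conj \<phi> \<psi>)
  then show ?case
    by (auto dest!: subsetD)
qed (auto simp: fv_rename_tm)

lemma val_rename_tm: "val M e (rename_tm f t) = val M (\<lambda>i. e (f i)) t"
proof (induction t)
  case (App g ts)
  then have "map (\<lambda>t. val M e (rename_tm f t)) ts = map (val M (\<lambda>i. e (f i))) ts"
    by (auto intro!: map_cong)
  then show ?case
    by (simp add: comp_def del: map_eq_conv)
qed simp

lemma sat_rename: "sat M e (rename f \<phi>) = sat M (\<lambda>i. e (f i)) \<phi>"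
proof (induction \<phi> arbitrary: e f)
  case (Pred p ts)
  show ?case
    by (simp add: comp_def val_rename_tm)
next
  case (Exists x \<phi>)
  define y where "y = (SOME y. y \<notin> f ` fv \<phi>)"
  have "\<exists>y. y \<notin> f ` fv \<phi>"
    using ex_new_if_finite[of "f ` fv \<phi>"] finite_fv by blast
  then have y: "y \<notin> f ` fv \<phi>"
    unfolding y_def by (rule someI_ex)
  have "sat M (\<lambda>i. (e(y := a)) ((f(x := y)) i)) \<phi> = sat M ((\<lambda>i. e (f i))(x := a)) \<phi>" for a
    using y by (intro sat_cong) auto
  then show ?case
    using Exists.IH by (simp add: Let_def flip: y_def)
qed (auto simp: val_rename_tm)

text \<open>Predicates on assignments are used like formulas in de Bruijn style: a quantifier binds
  position \<open>0\<close> and shifts the other positions.\<close>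

definition definable :: "((nat \<Rightarrow> nat) \<Rightarrow> bool) \<Rightarrow> bool" where
  "definable P \<longleftrightarrow> (\<exists>\<phi>. wf_fm add_lang \<phi> \<and> (\<forall>e. sat nat_add e \<phi> = P e))"

definition definable_fun :: "((nat \<Rightarrow> nat) \<Rightarrow> nat) \<Rightarrow> bool" where
  "definable_fun t \<longleftrightarrow> definable (\<lambda>e. e 0 = t (\<lambda>i. e (Suc i)))"

section \<open>Closure of definability under logical operations\<close>

lemma definable_rename:
  assumes "definable P"
  shows "definable (\<lambda>e. P (\<lambda>i. e (f i)))"
proof -
  obtain \<phi> where "wf_fm add_lang \<phi>" "\<forall>e. sat nat_add e \<phi> = P e"
    using assms unfolding definable_def by blast
  then show ?thesis
    unfolding definable_def by (intro exI[of _ "rename f \<phi>"]) (simp add: wf_rename sat_rename)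
qed

text \<open>Makes a relation known at position 0 available under further quantifiers, where its
  arguments have moved to other positions.\<close>

lemma definable_reindex:
  assumes "definable (\<lambda>e. P (e 0) (\<lambda>i. e (Suc i)))"
  shows "definable (\<lambda>e. P (e k) (\<lambda>i. e (f i)))"
  using definable_rename[OF assms, of "\<lambda>l. case l of 0 \<Rightarrow> k | Suc i \<Rightarrow> f i"] by simp

lemma definable_not:
  assumes "definable P"
  shows "definable (\<lambda>e. \<not> P e)"
proof -
  obtain \<phi> where "wf_fm add_lang \<phi>" "\<forall>e. sat nat_add e \<phi> = P e"
    using assms unfolding definable_def by blast
  then show ?thesis
    unfolding definable_def by (intro exI[of _ "Neg \<phi>"]) simp
qed

lemma definable_conj:
  assumes "definable P" "definable Q"
  shows "definable (\<lambda>e. P e \<and> Q e)"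
proof -
  obtain \<phi> \<psi> where "wf_fm add_lang \<phi>" "\<forall>e. sat nat_add e \<phi> = P e"
      "wf_fm add_lang \<psi>" "\<forall>e. sat nat_add e \<psi> = Q e"
    using assms unfolding definable_def by blast
  then show ?thesis
    unfolding definable_def by (intro exI[of _ "Conj \<phi> \<psi>"]) simp
qed

lemma definable_disj:
  assumes "definable P" "definable Q"
  shows "definable (\<lambda>e. P e \<or> Q e)"
  using definable_not[OF definable_conj[OF assms[THEN definable_not]]] by simp

lemma definable_imp:
  assumes "definable P" "definable Q"
  shows "definable (\<lambda>e. P e \<longrightarrow> Q e)"
  unfolding imp_conv_disj by (rule definable_disj[OF definable_not[OF assms(1)] assms(2)])

lemma definable_ex:
  assumes "definable (\<lambda>e. P (e 0) (\<lambda>i. e (Suc i)))"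
  shows "definable (\<lambda>e. \<exists>a. P a e)"
proof -
  obtain \<phi> where \<phi>: "wf_fm add_lang \<phi>"
      "\<forall>e. sat nat_add e \<phi> = P (e 0) (\<lambda>i. e (Suc i))"
    using assms unfolding definable_def by blast
  have "definable (\<lambda>e. \<exists>a. P a (\<lambda>i. e (Suc i)))"
    unfolding definable_def
    by (rule exI[of _ "Exists 0 \<phi>"]) (use \<phi> in \<open>simp add: nat_add_def\<close>)
  \<comment> \<open>\<open>Exists 0\<close> overwrites position 0, so the parameters start at
    position 1; renaming by \<open>i - 1\<close> moves them back to start at 0.\<close>
  from definable_rename[OF this, of "\<lambda>i. i - 1"] show ?thesis
    by simp
qed

lemma definable_all:
  assumes "definable (\<lambda>e. P (e 0) (\<lambda>i. e (Suc i)))"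
  shows "definable (\<lambda>e. \<forall>a. P a e)"
  using definable_not[OF definable_ex[of "\<lambda>a e. \<not> P a e", OF definable_not[OF assms]]] by simp

lemma definable_subst:
  assumes "definable_fun t" and "definable (\<lambda>e. P (e 0) (\<lambda>i. e (Suc i)))"
  shows "definable (\<lambda>e. P (t e) e)"
  using definable_ex[of "\<lambda>a e. a = t e \<and> P a e",
      OF definable_conj[OF assms(1)[unfolded definable_fun_def] assms(2)]] by simp

lemma definable_formula:
  assumes "formula_in add_lang n \<phi>" and "length ixs = n"
  shows "definable (\<lambda>e. sat_at nat_add (map e ixs) \<phi>)"
proof -
  have "sat nat_add (nth (map e ixs)) \<phi> = sat nat_add e (rename (nth ixs) \<phi>)" for e
    unfolding sat_rename using assms by (intro sat_cong) (auto simp: formula_in_def)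
  then show ?thesis
    unfolding definable_def sat_at_def using assms(1)
    by (intro exI[of _ "rename (nth ixs) \<phi>"]) (simp add: formula_in_def wf_rename)
qed

lemma formula_if_definable:
  assumes "definable (\<lambda>e. R (e 0) (e (Suc 0)))"
  obtains F where "formula_in add_lang 2 F" "\<And>x y. sat_at nat_add [x, y] F = R x y"
proof -
  obtain \<phi> where \<phi>: "wf_fm add_lang \<phi>" "\<forall>e. sat nat_add e \<phi> = R (e 0) (e (Suc 0))"
    using assms unfolding definable_def by blast
  \<comment> \<open>The formula may mention further variables, on which its truth does not depend.
    Collapsing them all to variable 1 leaves only 0 and 1 free.\<close>
  let ?F = "rename (\<lambda>i. min i 1) \<phi>"
  have "fv ?F \<subseteq> {..<2}"
    using fv_rename[of "\<lambda>i. min i 1" \<phi>] by fastforce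
  moreover have "sat_at nat_add [x, y] ?F = R x y" for x y
    using \<phi>(2) by (simp add: sat_at_def sat_rename)
  ultimately show thesis
    using that[of ?F] \<phi>(1) by (simp add: formula_in_def wf_rename)
qed

section \<open>Definable arithmetic: order, constants, least elements, bounded sums\<close>

lemma definable_var_eq: "definable (\<lambda>e. e i = e j)"
  unfolding definable_def by (rule exI[of _ "Eq (Var i) (Var j)"]) simp

lemma definable_var_add_eq: "definable (\<lambda>e. e i = e j + e k)"
  unfolding definable_def
  by (rule exI[of _ "Eq (Var i) (App Plus [Var j, Var k])"]) (simp add: add_lang_def nat_add_def)

lemma definable_fun_var: "definable_fun (\<lambda>e. e i)"
  unfolding definable_fun_def by (rule definable_var_eq)

lemma definable_fun_shift: "definable_fun t \<Longrightarrow> definable_fun (\<lambda>e. t (\<lambda>i. e (Suc i)))"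
  unfolding definable_fun_def by (rule definable_reindex)

lemma definable_eq:
  assumes "definable_fun s" "definable_fun t"
  shows "definable (\<lambda>e. s e = t e)"
  using definable_subst[OF assms(1), of "\<lambda>a e. a = t e"] assms(2)
  unfolding definable_fun_def by blast

lemma definable_fun_add:
  assumes "definable_fun s" "definable_fun t"
  shows "definable_fun (\<lambda>e. s e + t e)"
proof -
  have ex: "c = s e + t e \<longleftrightarrow> (\<exists>a b. a = s e \<and> b = t e \<and> c = a + b)" for c e
    by simp
  have "definable (\<lambda>e. e k = s (\<lambda>i. e (f i)))" "definable (\<lambda>e. e k = t (\<lambda>i. e (f i)))" for k f
    using assms[unfolded definable_fun_def, THEN definable_reindex] by auto
  then show ?thesis
    unfolding definable_fun_def ex
    by (intro definable_ex definable_conj definable_var_add_eq)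
qed

lemma definable_fun_zero: "definable_fun (\<lambda>e. 0)"
proof -
  \<comment> \<open>Zero is the only idempotent of addition.\<close>
  have "definable (\<lambda>e. e 0 = e 0 + e 0)"
    by (rule definable_var_add_eq)
  then show ?thesis
    unfolding definable_fun_def by simp
qed

lemma definable_le:
  assumes "definable_fun s" "definable_fun t"
  shows "definable (\<lambda>e. s e \<le> t e)"
  unfolding le_iff_add
  by (intro definable_ex definable_eq definable_fun_add definable_fun_var
      assms[THEN definable_fun_shift])

lemma definable_less:
  assumes "definable_fun s" "definable_fun t"
  shows "definable (\<lambda>e. s e < t e)"
  unfolding not_le[symmetric] by (intro definable_not definable_le assms)

lemma definable_fun_one: "definable_fun (\<lambda>e. 1)"
proof -
  have one: "n = 1 \<longleftrightarrow> n \<noteq> 0 \<and> (\<forall>a. a < n \<longrightarrow> a = 0)" for n :: nat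
    by presburger
  show ?thesis
    unfolding definable_fun_def one
    by (intro definable_conj definable_not definable_all definable_imp definable_less definable_eq
        definable_fun_var definable_fun_zero)
qed

lemma definable_fun_const: "definable_fun (\<lambda>e. n)"
proof (induction n)
  case (Suc n)
  then show ?case
    using definable_fun_add[OF _ definable_fun_one] by simp
qed (rule definable_fun_zero)

lemma definable_fun_mult: "definable_fun t \<Longrightarrow> definable_fun (\<lambda>e. n * t e)"
  by (induction n) (simp_all add: definable_fun_zero definable_fun_add)

text \<open>The default 0 for an empty fibre is the value that contributes nothing to the sums in
  \<open>definable_fun_sum\<close>.\<close>

lemma definable_fun_least:
  assumes R: "definable (\<lambda>e. R (e 0) (\<lambda>i. e (Suc i)))"
  shows "definable_fun (\<lambda>e. if \<exists>a. R a e then LEAST a. R a e else 0)"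
proof -
  have least: "b = (if \<exists>a. P a then LEAST a. P a else 0) \<longleftrightarrow>
      (P b \<and> (\<forall>a. P a \<longrightarrow> b \<le> a)) \<or> ((\<forall>a. \<not> P a) \<and> b = 0)" for P and b :: nat
  proof (cases "\<exists>a. P a")
    case True
    then show ?thesis
      using LeastI_ex[OF True] Least_le[of P] by (auto intro: antisym)
  qed simp
  show ?thesis
    unfolding definable_fun_def least
    by (intro definable_disj definable_conj definable_not definable_all definable_imp definable_le
        definable_eq definable_fun_var definable_fun_zero definable_reindex[OF R])
qed

text \<open>Induction on the bound \<open>K\<close>: the least element of a fibre is definable, and
  removing it leaves at most \<open>K\<close> elements. The uniform bound turns the sum into a fixed
  number of additions.\<close>

lemma definable_fun_sum:
  assumes "definable (\<lambda>e. R (e 0) (\<lambda>i. e (Suc i)))"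
    and "\<And>e. finite {a. R a e} \<and> card {a. R a e} \<le> K"
  shows "definable_fun (\<lambda>e. \<Sum>{a. R a e})"
  using assms
proof (induction K arbitrary: R)
  case 0
  then have "{a. R a e} = {}" for e
    by (metis card_0_eq le_zero_eq)
  then show ?case
    by (simp add: definable_fun_zero)
next
  case (Suc K)
  \<comment> \<open>The fibre without its least element, phrased by a quantifier so that it is
    visibly definable.\<close>
  let ?R' = "\<lambda>a e. R a e \<and> (\<exists>b. R b e \<and> b < a)"
  let ?m = "\<lambda>e. if \<exists>a. R a e then LEAST a. R a e else 0"
  have def: "definable (\<lambda>e. ?R' (e 0) (\<lambda>i. e (Suc i)))"
    by (intro definable_conj definable_ex definable_less definable_fun_var
        definable_reindex[OF Suc.prems(1)])
  have split: "{a. ?R' a e} = {a. R a e} - {LEAST a. R a e}" for e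
  proof -
    have "(\<exists>b. R b e \<and> b < a) \<longleftrightarrow> a \<noteq> (LEAST a. R a e)" if "R a e" for a
      using LeastI[of "\<lambda>a. R a e", OF that] Least_le[of "\<lambda>a. R a e", OF that]
        not_less_Least[of _ "\<lambda>a. R a e"] by (metis nless_le)
    then show ?thesis
      by auto
  qed
  have "finite {a. ?R' a e} \<and> card {a. ?R' a e} \<le> K" for e
  proof (cases "\<exists>a. R a e")
    case True
    then have "(LEAST a. R a e) \<in> {a. R a e}"
      by (auto intro: LeastI)
    then show ?thesis
      unfolding split using Suc.prems(2)[of e] by (simp add: le_diff_conv)
  qed simp
  with def have sum: "definable_fun (\<lambda>e. \<Sum>{a. ?R' a e})"
    by (rule Suc.IH)
  have eq: "?m e + \<Sum>{a. ?R' a e} = \<Sum>{a. R a e}" for e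
  proof (cases "\<exists>a. R a e")
    case True
    then have "(LEAST a. R a e) \<in> {a. R a e}"
      by (auto intro: LeastI)
    then show ?thesis
      unfolding split using Suc.prems(2)[of e] True by (simp add: sum.remove)
  qed simp
  show ?case
    using definable_fun_add[OF definable_fun_least[OF Suc.prems(1)] sum] unfolding eq .
qed

text \<open>Periodicity of the fibres up to few exceptions. Both \<open>N\<close> and
  \<open>K\<close> are chosen before \<open>b\<close>: a common \<open>N\<close> is needed for the
  pigeonhole argument, a common \<open>K\<close> for the definability of sums. The parameter type
  stays open since quantifier elimination uses lists of integers.\<close>

definition tame :: "('b \<Rightarrow> nat \<Rightarrow> bool) \<Rightarrow> bool" where
  "tame P \<longleftrightarrow> (\<exists>N>0. \<exists>K. \<forall>b. finite {y. P b y \<noteq> P b (y + N)} \<and> card {y. P b y \<noteq> P b (y + N)} \<le> K)"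

text \<open>Shifting raises the sum of \<open>X\<close> by \<open>N\<close> for each element, and
  the contribution of \<open>X \<inter> Y\<close> cancels.\<close>

lemma sum_shift_diff:
  fixes X :: "nat set" and N :: nat
  assumes "finite X"
  defines "Y \<equiv> (\<lambda>y. y + N) ` X"
  shows "\<Sum>(Y - X) = \<Sum>(X - Y) + N * card X"
proof -
  have "\<Sum>Y = \<Sum>X + N * card X"
    unfolding Y_def by (simp add: sum.reindex sum.distrib)
  moreover have "\<Sum>Y = \<Sum>(Y - X) + \<Sum>(X \<inter> Y)" "\<Sum>X = \<Sum>(X - Y) + \<Sum>(X \<inter> Y)"
    using assms sum.Int_Diff[of Y "\<lambda>x. x" X] sum.Int_Diff[of X "\<lambda>x. x" Y]
    by (simp_all add: Int_commute)
  ultimately show ?thesis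
    by simp
qed

text \<open>The cardinality of a finite fibre is read off from the boundedly many places where it changes,
  by \<open>sum_shift_diff\<close>.\<close>

lemma definable_card_eq:
  fixes R :: "nat \<Rightarrow> nat \<Rightarrow> bool"
  assumes tame: "tame R" and fin: "\<And>x. finite {y. R x y}"
    and R: "definable (\<lambda>e. R (e 0) (e (Suc 0)))"
  shows "definable (\<lambda>e. e (Suc 0) = card {y. R (e 0) y})"
proof -
  obtain N K where N: "N > 0" and K: "\<And>x. finite {y. R x y \<noteq> R x (y + N)}"
      "\<And>x. card {y. R x y \<noteq> R x (y + N)} \<le> K"
    using tame unfolding tame_def by blast
  let ?X = "\<lambda>x. {y. R x y}"
  let ?S = "\<lambda>y x. \<exists>v. y = v + N \<and> R x v"
  let ?P = "\<lambda>y e. ?S y (e 0) \<and> \<not> R (e 0) y"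
  let ?Q = "\<lambda>y e. R (e 0) y \<and> \<not> ?S y (e (0 :: nat))"
  have P_eq: "{y. ?P y e} = (\<lambda>y. y + N) ` ?X (e 0) - ?X (e 0)"
    and Q_eq: "{y. ?Q y e} = ?X (e 0) - (\<lambda>y. y + N) ` ?X (e 0)" for e
    by auto
  have Rij: "definable (\<lambda>e. R (e i) (e j))" for i j
    using definable_rename[OF R, of "\<lambda>k. if k = 0 then i else j"] by simp
  have S: "definable (\<lambda>e. ?S (e i) (e j))" for i j
    by (intro definable_ex definable_conj definable_eq definable_fun_add definable_fun_const
        definable_fun_var Rij)
  have P_card: "finite {y. ?P y e} \<and> card {y. ?P y e} \<le> K" for e
  proof -
    have "{y. ?P y e} \<subseteq> (\<lambda>y. y + N) ` {y. R (e 0) y \<noteq> R (e 0) (y + N)}"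
      by auto
    then show ?thesis
      using K[of "e 0"] by (meson card_image_le card_mono finite_imageI finite_subset order_trans)
  qed
  have Q_card: "finite {y. ?Q y e} \<and> card {y. ?Q y e} \<le> K" for e
  proof -
    \<comment> \<open>The change places do not account for elements of the fibre below
      \<open>N\<close>. Instead, a finite set and its shift have equal size, so their two
      differences have equal size and share the bound \<open>K\<close>.\<close>
    have "card ((\<lambda>y. y + N) ` ?X (e 0)) = card (?X (e 0))"
      by (simp add: card_image)
    then have "card {y. ?Q y e} = card {y. ?P y e}"
      unfolding P_eq Q_eq using fin[of "e 0"]
      by (simp add: card_Diff_subset_Int Int_commute)
    then show ?thesis
      using P_card fin by simp
  qed
  have "definable_fun (\<lambda>e. \<Sum>{y. ?P y e})"
    by (rule definable_fun_sum[OF _ P_card]) (intro definable_conj definable_not Rij S)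
  moreover have "definable_fun (\<lambda>e. \<Sum>{y. ?Q y e})"
    by (rule definable_fun_sum[OF _ Q_card]) (intro definable_conj definable_not Rij S)
  ultimately have def: "definable (\<lambda>e. \<Sum>{y. ?P y e} = \<Sum>{y. ?Q y e} + N * e (Suc 0))"
    by (intro definable_eq definable_fun_add definable_fun_mult definable_fun_var)
  \<comment> \<open>Since \<open>N > 0\<close>, the linear equation has the cardinality as its only
    solution.\<close>
  have eq: "\<Sum>{y. ?P y e} = \<Sum>{y. ?Q y e} + N * e (Suc 0) \<longleftrightarrow> e (Suc 0) = card (?X (e 0))" for e
    unfolding P_eq Q_eq using sum_shift_diff[OF fin, of N "e 0"] N by auto
  show ?thesis
    using def unfolding eq .
qed

section \<open>Quantifier elimination\<close>

text \<open>Telescoping: a change across \<open>M * N\<close> forces a change across one of the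
  \<open>M\<close> steps of length \<open>N\<close>, and each step allows at most \<open>K\<close>
  such places.\<close>

lemma tame_mult:
  assumes fin: "finite {y. P y \<noteq> P (y + N)}" and card: "card {y. P y \<noteq> P (y + N)} \<le> K"
  shows "finite {y. P y \<noteq> P (y + M * N)} \<and> card {y. P y \<noteq> P (y + M * N)} \<le> M * K"
    (is "finite (?D M) \<and> _")
proof (induction M)
  case (Suc M)
  let ?S = "{y. P (y + M * N) \<noteq> P (y + M * N + N)}"
  have sub: "(\<lambda>y. y + M * N) ` ?S \<subseteq> {y. P y \<noteq> P (y + N)}"
    by auto
  have inj: "inj_on (\<lambda>y. y + M * N) ?S"
    by (auto intro: inj_onI)
  have S: "finite ?S" "card ?S \<le> K"
    using finite_imageD[OF finite_subset[OF sub fin] inj]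
      order_trans[OF card_inj_on_le[OF inj sub fin] card] by blast+
  have D: "?D (Suc M) \<subseteq> ?D M \<union> ?S"
    by (auto simp: add_ac)
  have "card (?D (Suc M)) \<le> card (?D M \<union> ?S)"
    using D Suc S by (intro card_mono) auto
  also have "\<dots> \<le> card (?D M) + card ?S"
    by (rule card_Un_le)
  finally show ?case
    using D Suc S finite_subset[OF D] by auto
qed simp

text \<open>The product of the two shifts serves both relations, and the combination can only change
  where one of its arguments does.\<close>

lemma tame_binary:
  assumes "tame P" "tame Q"
  shows "tame (\<lambda>b y. f (P b y) (Q b y))"
proof -
  obtain N K where N: "N > 0" and
    P: "\<And>b. finite {y. P b y \<noteq> P b (y + N)}" "\<And>b. card {y. P b y \<noteq> P b (y + N)} \<le> K"
    using assms(1) unfolding tame_def by blast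
  obtain M L where M: "M > 0" and
    Q: "\<And>b. finite {y. Q b y \<noteq> Q b (y + M)}" "\<And>b. card {y. Q b y \<noteq> Q b (y + M)} \<le> L"
    using assms(2) unfolding tame_def by blast
  let ?n = "M * N"
  have "finite {y. f (P b y) (Q b y) \<noteq> f (P b (y + ?n)) (Q b (y + ?n))} \<and>
    card {y. f (P b y) (Q b y) \<noteq> f (P b (y + ?n)) (Q b (y + ?n))} \<le> M * K + N * L"
    (is "finite ?D \<and> _") for b
  proof -
    let ?DP = "{y. P b y \<noteq> P b (y + ?n)}" and ?DQ = "{y. Q b y \<noteq> Q b (y + ?n)}"
    have DP: "finite ?DP" "card ?DP \<le> M * K"
      using tame_mult[of "P b" N K M] P by auto
    have DQ: "finite ?DQ" "card ?DQ \<le> N * L"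
      using tame_mult[of "Q b" M L N] Q by (auto simp: mult.commute)
    have D: "?D \<subseteq> ?DP \<union> ?DQ"
      by (rule subsetI, rule ccontr) simp
    have "card ?D \<le> card (?DP \<union> ?DQ)"
      using D DP DQ by (intro card_mono) auto
    also have "\<dots> \<le> card ?DP + card ?DQ"
      by (rule card_Un_le)
    finally show ?thesis
      using D DP DQ finite_subset[OF D] by auto
  qed
  moreover have "?n > 0"
    using N M by simp
  ultimately show ?thesis
    unfolding tame_def by blast
qed

lemma tame_not: "tame P \<Longrightarrow> tame (\<lambda>b y. \<not> P b y)"
  using tame_binary[of P P "\<lambda>p q. \<not> p"] .

lemma tame_periodic:
  assumes "N > 0" "\<And>b y. P b (y + N) = P b y"
  shows "tame P"
proof -
  have "{y. P b y \<noteq> P b (y + N)} = {}" for b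
    using assms by simp
  then show ?thesis
    unfolding tame_def using assms(1) by (metis card.empty finite.emptyI order_refl)
qed

lemma mono_change_unique:
  fixes P :: "nat \<Rightarrow> bool"
  assumes "\<And>y. P y \<Longrightarrow> P (Suc y)"
  shows "\<exists>c. {y. P y \<noteq> P (y + 1)} \<subseteq> {c}"
proof (cases "\<exists>y. P y \<noteq> P (y + 1)")
  case True
  have up: "P y \<Longrightarrow> y \<le> y' \<Longrightarrow> P y'" for y y'
    using lift_Suc_mono_le[of P y y'] assms by auto
  from True obtain c where c: "\<not> P c" "P (Suc c)"
    using assms by auto
  have "y = c" if "P y \<noteq> P (y + 1)" for y
  proof -
    have y: "\<not> P y" "P (Suc y)"
      using that assms by auto
    show ?thesis
      using up[of "Suc y" c] up[of "Suc c" y] y c by (metis Suc_leI linorder_neqE_nat)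
  qed
  then show ?thesis
    by blast
qed blast

text \<open>A monotone fibre changes at most once, so shift 1 and bound 1 suffice; the direction may
  depend on \<open>b\<close>.\<close>

lemma tame_monotone:
  assumes "\<And>b. (\<forall>y. P b y \<longrightarrow> P b (Suc y)) \<or> (\<forall>y. P b (Suc y) \<longrightarrow> P b y)"
  shows "tame P"
proof -
  have "finite {y. P b y \<noteq> P b (y + 1)} \<and> card {y. P b y \<noteq> P b (y + 1)} \<le> 1" for b
  proof -
    obtain c where c: "{y. P b y \<noteq> P b (y + 1)} \<subseteq> {c}"
      using assms[of b] mono_change_unique[of "P b"] mono_change_unique[of "\<lambda>y. \<not> P b y"] by auto
    then show ?thesis
      using finite_subset[OF c] card_mono[OF _ c] by simp
  qed
  then show ?thesis
    unfolding tame_def by (intro exI[of _ 1] conjI exI[of _ 1] allI) auto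
qed

section \<open>Quantifier-free formulas as functions of their first variable\<close>

fun head_coeff :: "Cooper.num \<Rightarrow> int" where
  "head_coeff (Cooper.C c) = 0"
| "head_coeff (Bound n) = (if n = 0 then 1 else 0)"
| "head_coeff (CN n c t) = (if n = 0 then c else 0) + head_coeff t"
| "head_coeff (Cooper.Neg t) = - head_coeff t"
| "head_coeff (Add s t) = head_coeff s + head_coeff t"
| "head_coeff (Sub s t) = head_coeff s - head_coeff t"
| "head_coeff (Mul c t) = c * head_coeff t"

lemma Inum_Cons: "Inum (y # bs) t = head_coeff t * y + Inum (0 # bs) t"
  by (induction t) (auto simp: algebra_simps nth_Cons')

text \<open>With the slope in \<open>y\<close> fixed by the term, inequalities are monotone in
  \<open>y\<close> and divisibility by a nonzero \<open>d\<close> is periodic with period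
  \<open>\<bar>d\<bar>\<close>; Boolean combinations preserve tameness.\<close>

lemma tame_qfree:
  assumes "qfree p"
  shows "tame (\<lambda>bs y. Ifm bbs (int y # bs) p)"
proof -
  have le: "tame (\<lambda>bs y. Inum (int y # bs) t \<le> 0)" and lt: "tame (\<lambda>bs y. Inum (int y # bs) t < 0)"
    and dvd: "tame (\<lambda>bs y. d dvd Inum (int y # bs) t)" for t d
  proof -
    define a where "a = head_coeff t"
    have a: "Inum (y # bs) t = a * y + Inum (0 # bs) t" for y bs
      unfolding a_def by (rule Inum_Cons)
    have step: "Inum (int (Suc y) # bs) t = Inum (int y # bs) t + a" for y bs
      using a[of "int (Suc y)" bs] a[of "int y" bs] by (simp add: algebra_simps)
    show le: "tame (\<lambda>bs y. Inum (int y # bs) t \<le> 0)"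
      by (rule tame_monotone, unfold step, cases "a \<le> 0") auto
    show "tame (\<lambda>bs y. Inum (int y # bs) t < 0)"
      by (rule tame_monotone, unfold step, cases "a \<le> 0") auto
    show "tame (\<lambda>bs y. d dvd Inum (int y # bs) t)"
    proof (cases "d = 0")
      \<comment> \<open>Divisibility by 0 means equality with 0, a conjunction of two monotone
        conditions. Equations are later obtained from this case.\<close>
      case True
      have "tame (\<lambda>bs y. \<not> Inum (int y # bs) t < 0)"
        by (rule tame_not, rule tame_monotone, unfold step, cases "a \<le> 0") auto
      from tame_binary[OF le this, of "(\<and>)"]
      have "tame (\<lambda>bs y. Inum (int y # bs) t \<le> 0 \<and> \<not> Inum (int y # bs) t < 0)" .
      moreover have "v \<le> 0 \<and> \<not> v < 0 \<longleftrightarrow> d dvd v" for v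
        using True by auto
      ultimately show ?thesis
        by simp
    next
      case False
      show ?thesis
      proof (rule tame_periodic)
        show "nat \<bar>d\<bar> > 0"
          using False by simp
        fix bs y
        have "Inum (int (y + nat \<bar>d\<bar>) # bs) t = Inum (int y # bs) t + a * \<bar>d\<bar>"
          using a[of "int (y + nat \<bar>d\<bar>)" bs] a[of "int y" bs] by (simp add: algebra_simps)
        then show "d dvd Inum (int (y + nat \<bar>d\<bar>) # bs) t \<longleftrightarrow> d dvd Inum (int y # bs) t"
          by (simp add: dvd_add_left_iff)
      qed
    qed
  qed
  have const: "tame (\<lambda>bs y. c)" for c
    by (rule tame_periodic[of 1]) auto
  have eq: "tame (\<lambda>bs y. Inum (int y # bs) t = 0)" for t
    using dvd[of 0 t] by simp
  show ?thesis
    using assms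
  proof (induction p)
    case (Gt t)
    show ?case
      using tame_not[OF le[of t]] by (simp add: not_le)
  next
    case (Ge t)
    show ?case
      using tame_not[OF lt[of t]] by (simp add: not_less)
  next
    case (NEq t)
    show ?case
      using tame_not[OF eq[of t]] by simp
  next
    case (NDvd d t)
    show ?case
      using tame_not[OF dvd[of d t]] by simp
  next
    case (Not p)
    then show ?case
      using tame_not by simp
  next
    case (And p q)
    then show ?case
      using tame_binary[of _ _ "(\<and>)"] by simp
  next
    case (Or p q)
    then show ?case
      using tame_binary[of _ _ "(\<or>)"] by simp
  next
    case (Imp p q)
    then show ?case
      using tame_binary[of _ _ "(\<longrightarrow>)"] by simp
  next
    case (Iff p q)
    then show ?case
      using tame_binary[of _ _ "(=)"] by simp
  qed (simp_all add: le lt eq dvd const)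
qed

section \<open>Translation into Cooper's formulas over the integers\<close>

fun index_of :: "nat \<Rightarrow> nat list \<Rightarrow> nat" where
  "index_of x [] = 0"
| "index_of x (v # vs) = (if x = v then 0 else Suc (index_of x vs))"

fun cooper_tm :: "nat list \<Rightarrow> add_sym tm \<Rightarrow> Cooper.num" where
  "cooper_tm vs (Var x) = Bound (index_of x vs)"
| "cooper_tm vs (App f ts) = foldr Cooper.Add (map (cooper_tm vs) ts) (Cooper.C 0)"

text \<open>Cooper's quantifiers range over the integers, hence the guard
  \<open>Ge (Bound 0)\<close>. The list \<open>vs\<close> names the de Bruijn positions; as
  \<open>index_of\<close> finds the first occurrence, an inner binder shadows an outer one.
  \<open>Pred\<close> has no well-formed instance, so its translation is arbitrary.\<close>

fun cooper_fm :: "nat list \<Rightarrow> (add_sym, unit) Defs.fm \<Rightarrow> Cooper.fm" where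
  "cooper_fm vs (Defs.Eq s t) = Cooper.Eq (Sub (cooper_tm vs s) (cooper_tm vs t))"
| "cooper_fm vs (Pred p ts) = Cooper.F"
| "cooper_fm vs (Defs.Neg \<phi>) = Cooper.Not (cooper_fm vs \<phi>)"
| "cooper_fm vs (Conj \<phi> \<psi>) = And (cooper_fm vs \<phi>) (cooper_fm vs \<psi>)"
| "cooper_fm vs (Exists x \<phi>) = Cooper.E (And (Ge (Bound 0)) (cooper_fm (x # vs) \<phi>))"

lemma Inum_cooper_tm:
  assumes "wf_tm add_lang t" and "\<And>x. x \<in> fv_tm t \<Longrightarrow> bs ! index_of x vs = int (e x)"
  shows "Inum bs (cooper_tm vs t) = int (val nat_add e t)"
  using assms
proof (induction t)
  case (App f ts)
  then have "length ts = Suc (Suc 0)"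
    by (simp add: add_lang_def)
  then obtain s t where "ts = [s, t]"
    by (auto simp: length_Suc_conv)
  then show ?case
    using App by (simp add: nat_add_def)
qed simp

lemma Ifm_cooper_fm:
  assumes "wf_fm add_lang \<phi>" and "\<And>x. x \<in> fv \<phi> \<Longrightarrow> bs ! index_of x vs = int (e x)"
  shows "Ifm bbs bs (cooper_fm vs \<phi>) = sat nat_add e \<phi>"
  using assms
proof (induction \<phi> arbitrary: bs vs e)
  case (Eq s t)
  then have "Inum bs (cooper_tm vs s) = int (val nat_add e s)"
    "Inum bs (cooper_tm vs t) = int (val nat_add e t)"
    by (auto intro!: Inum_cooper_tm)
  then show ?case
    by simp
next
  case (Pred p ts)
  then show ?case
    by (simp add: add_lang_def)
next
  case (Exists x \<phi>)
  have "Ifm bbs (int a # bs) (cooper_fm (x # vs) \<phi>) = sat nat_add (e(x := a)) \<phi>" for a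
    using Exists.prems by (intro Exists.IH) auto
  moreover have "(\<exists>a. 0 \<le> a \<and> Ifm bbs (a # bs) \<psi>) \<longleftrightarrow> (\<exists>a. Ifm bbs (int a # bs) \<psi>)" for \<psi>
    by (metis nonneg_int_cases of_nat_0_le_iff)
  ultimately show ?case
    by (simp add: nat_add_def)
qed auto

text \<open>Cooper's procedure \<open>pa\<close> replaces the translated formula by an equivalent
  quantifier-free one, to which \<open>tame_qfree\<close> applies.\<close>

lemma tame_if_definable:
  assumes "definable (\<lambda>e. R (e 0) (e (Suc 0)))"
  shows "tame R"
proof -
  obtain \<phi> where \<phi>: "wf_fm add_lang \<phi>" "\<forall>e. sat nat_add e \<phi> = R (e 0) (e (Suc 0))"
    using assms unfolding definable_def by blast
  \<comment> \<open>Variable 1 is listed first because the fibre variable must head the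
    environment.\<close>
  define p where "p = pa (cooper_fm [1, 0] \<phi>)"
  have R: "(\<lambda>y. Ifm [] (int y # [int x, 0]) p) = R x" for x
  proof
    fix y
    \<comment> \<open>Every variable other than 0 and 1 gets index 2 in \<open>[1, 0]\<close>, so
      the trailing 0 of the environment is its value.\<close>
    let ?e = "\<lambda>i. if i = 0 then x else if i = 1 then y else 0"
    have "Ifm [] [int y, int x, 0] p = sat nat_add ?e \<phi>"
      unfolding p_def mirqe[THEN conjunct1] by (rule Ifm_cooper_fm) (simp_all add: \<phi>(1))
    then show "Ifm [] (int y # [int x, 0]) p = R x y"
      using \<phi>(2) by simp
  qed
  have "tame (\<lambda>bs y. Ifm [] (int y # bs) p)"
    unfolding p_def by (rule tame_qfree) (simp add: mirqe)
  then have "tame (\<lambda>x y. Ifm [] (int y # [int x, 0]) p)"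
    unfolding tame_def by meson
  then show ?thesis
    unfolding R .
qed

section \<open>Initial segments of models of Presburger arithmetic\<close>

text \<open>The facts about a model that the argument uses: a cancellative commutative monoid,
  linearly ordered by \<open>\<exists>w. x \<oplus> w = y\<close>, with least element
  \<open>z\<close> and least nonzero element \<open>u\<close>.\<close>

locale presburger_monoid =
  fixes C :: "'a set" and add :: "'a \<Rightarrow> 'a \<Rightarrow> 'a" (infixl "\<oplus>" 65) and z u :: 'a
  assumes closed: "x \<in> C \<Longrightarrow> y \<in> C \<Longrightarrow> x \<oplus> y \<in> C"
    and assoc: "x \<in> C \<Longrightarrow> y \<in> C \<Longrightarrow> w \<in> C \<Longrightarrow> x \<oplus> y \<oplus> w = x \<oplus> (y \<oplus> w)"
    and comm: "x \<in> C \<Longrightarrow> y \<in> C \<Longrightarrow> x \<oplus> y = y \<oplus> x"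
    and cancel: "x \<in> C \<Longrightarrow> y \<in> C \<Longrightarrow> w \<in> C \<Longrightarrow> x \<oplus> y = x \<oplus> w \<Longrightarrow> y = w"
    and zero_closed: "z \<in> C"
    and add_zero: "x \<in> C \<Longrightarrow> x \<oplus> z = x"
    and zero_sum: "x \<in> C \<Longrightarrow> y \<in> C \<Longrightarrow> x \<oplus> y = z \<Longrightarrow> x = z"
    and linear: "x \<in> C \<Longrightarrow> y \<in> C \<Longrightarrow> \<exists>w\<in>C. x \<oplus> w = y \<or> y \<oplus> w = x"
    and one_closed: "u \<in> C"
    and one_neq_zero: "u \<noteq> z"
    and pred_exists: "x \<in> C \<Longrightarrow> x \<noteq> z \<Longrightarrow> \<exists>y\<in>C. x = y \<oplus> u"
begin

definition seg :: "'a \<Rightarrow> 'a set" where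
  "seg x = {y \<in> C. y \<noteq> x \<and> (\<exists>w\<in>C. y \<oplus> w = x)}"

fun mult :: "nat \<Rightarrow> 'a \<Rightarrow> 'a" where
  "mult 0 x = z"
| "mult (Suc n) x = x \<oplus> mult n x"

lemma mult_closed: "x \<in> C \<Longrightarrow> mult n x \<in> C"
  by (induction n) (auto simp: closed zero_closed)

lemma zero_add: "x \<in> C \<Longrightarrow> z \<oplus> x = x"
  using comm add_zero zero_closed by metis

lemma mult_add: "x \<in> C \<Longrightarrow> mult (m + n) x = mult m x \<oplus> mult n x"
  by (induction m) (auto simp: zero_add mult_closed assoc)

lemma add_inj: "x \<in> C \<Longrightarrow> inj_on ((\<oplus>) x) C"
  using cancel by (auto intro: inj_onI)

lemma seg_subset: "seg x \<subseteq> C"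
  by (auto simp: seg_def)

lemma seg_zero: "seg z = {}"
  using zero_sum by (auto simp: seg_def)

lemma zero_in_seg: "x \<in> C \<Longrightarrow> x \<noteq> z \<Longrightarrow> z \<in> seg x"
  using zero_closed zero_add by (auto simp: seg_def)

text \<open>If \<open>v \<oplus> w = u\<close> with \<open>w\<close> nonzero, then \<open>w\<close>
  has a summand \<open>u\<close>; cancelling it leaves \<open>v \<oplus> w' = z\<close>, which
  forces \<open>v = z\<close>.\<close>

lemma seg_one: "seg u = {z}"
proof -
  have "v = z" if "v \<in> seg u" for v
  proof -
    from that obtain w where v: "v \<in> C" "v \<noteq> u" and w: "w \<in> C" "v \<oplus> w = u"
      by (auto simp: seg_def)
    then have "w \<noteq> z"
      using add_zero by auto
    then obtain w' where w': "w' \<in> C" "w = w' \<oplus> u"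
      using pred_exists w by blast
    then have "u \<oplus> (v \<oplus> w') = u \<oplus> z"
      using v w add_zero one_closed assoc comm by metis
    then have "v \<oplus> w' = z"
      using v w' cancel closed zero_closed one_closed by blast
    then show ?thesis
      using v w' zero_sum by blast
  qed
  then show ?thesis
    using zero_in_seg[OF one_closed one_neq_zero] by blast
qed

text \<open>By linearity an element below \<open>x \<oplus> y\<close> is either below
  \<open>x\<close> or of the form \<open>x \<oplus> t\<close>, and cancellation puts
  \<open>t\<close> below \<open>y\<close>. Additivity of the counts and infinite differences both
  come from this splitting.\<close>

lemma seg_add:
  assumes x: "x \<in> C" and y: "y \<in> C"
  shows "seg (x \<oplus> y) = seg x \<union> (\<oplus>) x ` seg y" and "seg x \<inter> (\<oplus>) x ` seg y = {}"
proof -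
  have "v \<in> seg (x \<oplus> y)" if "v \<in> seg x" for v
  proof -
    from that obtain w where v: "v \<in> C" "v \<noteq> x" and w: "w \<in> C" "v \<oplus> w = x"
      by (auto simp: seg_def)
    have eq: "v \<oplus> (w \<oplus> y) = x \<oplus> y"
      using v w y assoc by metis
    moreover have "v \<noteq> x \<oplus> y"
    proof
      assume "v = x \<oplus> y"
      then have "v \<oplus> (w \<oplus> y) = v \<oplus> z"
        using eq v add_zero by simp
      then have "w = z"
        using v w y cancel closed zero_closed zero_sum by blast
      then show False
        using v w add_zero by simp
    qed
    ultimately show ?thesis
      using v w y closed by (auto simp: seg_def)
  qed
  moreover have "x \<oplus> v \<in> seg (x \<oplus> y)" if "v \<in> seg y" for v
  proof -
    from that obtain w where v: "v \<in> C" "v \<noteq> y" and w: "w \<in> C" "v \<oplus> w = y"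
      by (auto simp: seg_def)
    have "x \<oplus> v \<noteq> x \<oplus> y"
      using v x y cancel by blast
    moreover have "x \<oplus> v \<oplus> w = x \<oplus> y"
      using v w x assoc by simp
    ultimately show ?thesis
      using v w x closed by (auto simp: seg_def)
  qed
  moreover have "v \<in> seg x \<union> (\<oplus>) x ` seg y" if "v \<in> seg (x \<oplus> y)" for v
  proof -
    from that obtain w where v: "v \<in> C" "v \<noteq> x \<oplus> y" and w: "w \<in> C" "v \<oplus> w = x \<oplus> y"
      by (auto simp: seg_def)
    obtain t where t: "t \<in> C" "v \<oplus> t = x \<or> x \<oplus> t = v"
      using linear v x by blast
    show ?thesis
    proof (cases "x \<oplus> t = v")
      case True
      then have "x \<oplus> (t \<oplus> w) = x \<oplus> y"
        using w t x assoc by metis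
      then have "t \<oplus> w = y"
        using w t x y cancel closed by blast
      then have "t \<in> seg y"
        using t w v True by (auto simp: seg_def)
      then show ?thesis
        using True by blast
    next
      case False
      then show ?thesis
        using t v x add_zero by (auto simp: seg_def)
    qed
  qed
  ultimately show "seg (x \<oplus> y) = seg x \<union> (\<oplus>) x ` seg y"
    by blast
  have False if "v \<in> seg y" "x \<oplus> v \<in> seg x" for v
  proof -
    from that obtain w where v: "v \<in> C" "x \<oplus> v \<noteq> x" and w: "w \<in> C" "x \<oplus> v \<oplus> w = x"
      by (auto simp: seg_def)
    then have "x \<oplus> (v \<oplus> w) = x \<oplus> z"
      using x add_zero assoc by simp
    then have "v = z"
      using v w x cancel closed zero_closed zero_sum by blast
    then show False
      using v x add_zero by simp
  qed
  then show "seg x \<inter> (\<oplus>) x ` seg y = {}"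
    by blast
qed

lemma card_seg_add:
  assumes "x \<in> C" "y \<in> C" "finite (seg x)" "finite (seg y)"
  shows "card (seg (x \<oplus> y)) = card (seg x) + card (seg y)"
proof -
  have "inj_on ((\<oplus>) x) (seg y)"
    using add_inj[OF assms(1)] seg_subset by (rule inj_on_subset)
  then show ?thesis
    using assms seg_add[OF assms(1,2)] by (simp add: card_Un_disjoint card_image)
qed

text \<open>Of two elements one is the other plus some \<open>w\<close>; equal counts make the
  segment of \<open>w\<close> empty, so \<open>w = z\<close>. Every \<open>n\<close> is attained at
  the \<open>n\<close>-fold multiple of \<open>u\<close>.\<close>

lemma bij_betw_card_seg:
  assumes fin: "\<And>x. x \<in> C \<Longrightarrow> finite (seg x)"
  shows "bij_betw (\<lambda>x. card (seg x)) C UNIV"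
proof -
  have shift: "y = x" if "x \<in> C" "w \<in> C" "y = x \<oplus> w" "card (seg x) = card (seg y)" for x y w
  proof -
    have "card (seg w) = 0"
      using that card_seg_add[of x w] fin by simp
    then have "w = z"
      using zero_in_seg[of w] fin[of w] that by auto
    then show ?thesis
      using that add_zero by simp
  qed
  have "inj_on (\<lambda>x. card (seg x)) C"
    by (rule inj_onI) (metis linear shift)
  moreover have "card (seg (mult n u)) = n" for n
    by (induction n)
      (simp_all add: seg_zero card_seg_add fin mult_closed one_closed seg_one)
  ultimately show ?thesis
    unfolding bij_betw_def using mult_closed[OF one_closed] by (metis UNIV_eq_I image_eqI)
qed

text \<open>The difference is a translate of a segment that still contains
  \<open>seg c\<close>.\<close>

lemma infinite_seg_diff:
  assumes c: "c \<in> C" "infinite (seg c)" and "j < k"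
  shows "infinite (seg (mult k c) - seg (mult j c))"
proof -
  obtain d where k: "k = j + Suc d"
    using \<open>j < k\<close> less_iff_Suc_add by auto
  let ?x = "mult j c" and ?y = "c \<oplus> mult d c"
  have mem: "?x \<in> C" "?y \<in> C"
    using c mult_closed closed by auto
  have "mult k c = ?x \<oplus> ?y"
    using mult_add[OF c(1), of j "Suc d"] k by simp
  then have "seg (mult k c) - seg ?x = (\<oplus>) ?x ` seg ?y"
    using seg_add[OF mem] by auto
  moreover have "infinite (seg ?y)"
    using c seg_add(1)[OF c(1) mult_closed[OF c(1)]] by simp
  moreover have "inj_on ((\<oplus>) ?x) (seg ?y)"
    using add_inj[OF mem(1)] seg_subset by (rule inj_on_subset)
  ultimately show ?thesis
    by (simp add: finite_image_iff)
qed

end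

section \<open>Eventually periodic sets and finiteness of segments\<close>

lemma periodic_from:
  fixes m N :: nat
  assumes "\<And>y. y \<ge> m \<Longrightarrow> y \<in> S \<longleftrightarrow> y + N \<in> S" and "y \<ge> m"
  shows "y + k * N \<in> S \<longleftrightarrow> y \<in> S"
proof (induction k)
  case (Suc k)
  then show ?case
    using assms(1)[of "y + k * N"] assms(2) by (simp add: add_ac)
qed simp

text \<open>Up to finite differences there are at most \<open>2 ^ N\<close> eventually \<open>N\<close>-periodic sets.\<close>

lemma eventually_periodic_almost_subset:
  fixes S :: "nat \<Rightarrow> nat set"
  assumes N: "N > 0" and per: "\<And>k. finite {y. (y \<in> S k) \<noteq> (y + N \<in> S k)}"
  shows "\<exists>j k. j < k \<and> finite (S k - S j)"
proof -
  \<comment> \<open>These are \<open>2 ^ N + 1\<close> indices, one more than there are subsets of a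
    window of length \<open>N\<close>.\<close>
  let ?I = "{..(2::nat) ^ N}"
  have "finite (\<Union>k\<in>?I. {y. (y \<in> S k) \<noteq> (y + N \<in> S k)})"
    using per by blast
  then obtain m where m: "\<forall>y\<in>(\<Union>k\<in>?I. {y. (y \<in> S k) \<noteq> (y + N \<in> S k)}). y < m"
    using finite_nat_set_iff_bounded by blast
  then have step: "y \<in> S k \<longleftrightarrow> y + N \<in> S k" if "k \<in> ?I" "y \<ge> m" for k y
    using that by fastforce
  \<comment> \<open>The trace on the window from \<open>m\<close> to \<open>m + N - 1\<close>. All
    sets considered are exactly periodic from \<open>m\<close> on, so the trace determines them
    there.\<close>
  let ?sig = "\<lambda>k. {i. i < N \<and> m + i \<in> S k}"
  have "?sig ` ?I \<subseteq> Pow {..<N}"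
    by auto
  then have "card (?sig ` ?I) \<le> 2 ^ N"
    by (metis card_Pow card_lessThan card_mono finite_Pow_iff finite_lessThan)
  then have "\<not> inj_on ?sig ?I"
    using pigeonhole[of ?sig ?I] by simp
  then obtain j k where jk: "j \<in> ?I" "k \<in> ?I" "j < k" "?sig j = ?sig k"
    unfolding inj_on_def by (metis (no_types, lifting) linorder_neqE_nat)
  have "y < m" if "y \<in> S k - S j" for y
  proof (rule ccontr)
    assume "\<not> y < m"
    then obtain q i where y: "y = m + i + q * N" and i: "i < N"
      using N by (metis add.assoc add.commute div_mult_mod_eq le_add_diff_inverse mod_less_divisor not_less)
    have "y \<in> S l \<longleftrightarrow> i \<in> ?sig l" if "l \<in> ?I" for l
      using periodic_from[of m "S l" N "m + i" q, OF step[OF that] le_add1] i unfolding y by simp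
    then show False
      using jk that by blast
  qed
  then have "finite (S k - S j)"
    by (meson finite_nat_set_iff_bounded)
  then show ?thesis
    using jk by blast
qed

text \<open>Among the coded segments of the multiples of \<open>c\<close>, two would differ finitely
  in the direction where \<open>infinite_seg_diff\<close> gives an infinite difference; injectivity
  of \<open>rep\<close> carries this over to the codes.\<close>

lemma (in presburger_monoid) finite_seg_if_eventually_periodic:
  fixes rep :: "'a \<Rightarrow> nat"
  assumes inj: "inj_on rep C" and N: "N > 0"
    and per: "\<And>x. x \<in> C \<Longrightarrow> finite {y. (y \<in> rep ` seg x) \<noteq> (y + N \<in> rep ` seg x)}"
    and c: "c \<in> C"
  shows "finite (seg c)"
proof (rule ccontr)
  assume inf: "infinite (seg c)"
  obtain j k where jk: "j < k" "finite (rep ` seg (mult k c) - rep ` seg (mult j c))"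
    using eventually_periodic_almost_subset[of N "\<lambda>k. rep ` seg (mult k c)"]
      N per mult_closed[OF c] by blast
  have "rep ` seg (mult k c) - rep ` seg (mult j c) = rep ` (seg (mult k c) - seg (mult j c))"
    using inj_on_image_set_diff[OF inj] seg_subset by blast
  moreover have "inj_on rep (seg (mult k c) - seg (mult j c))"
    using inj seg_subset by (meson Diff_subset inj_on_subset)
  ultimately show False
    using jk infinite_seg_diff[OF c inf] by (simp add: finite_image_iff)
qed

section \<open>One-dimensional interpretations\<close>

lemma sat_if_model:
  assumes "is_model M PrA" "sentence add_lang \<phi>" "\<And>e. sat nat_add e \<phi>" "range e \<subseteq> dom M"
  shows "sat M e \<phi>"
  using assms unfolding is_model_def PrA_def theory_of_def holds_def by blast

abbreviation Plus_vars :: "nat \<Rightarrow> nat \<Rightarrow> add_sym tm" where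
  "Plus_vars i j \<equiv> App Plus [Var i, Var j]"

abbreviation Forall :: "nat \<Rightarrow> ('f, 'p) Defs.fm \<Rightarrow> ('f, 'p) Defs.fm" where
  "Forall i \<phi> \<equiv> Defs.Neg (Exists i (Defs.Neg \<phi>))"

abbreviation Implies :: "('f, 'p) Defs.fm \<Rightarrow> ('f, 'p) Defs.fm \<Rightarrow> ('f, 'p) Defs.fm" where
  "Implies \<phi> \<psi> \<equiv> Defs.Neg (Conj \<phi> (Defs.Neg \<psi>))"

text \<open>Each axiom except closure is a consequence of a sentence true in the natural numbers.
  Closure is a hypothesis because the record \<open>struct\<close> does not force operations to stay
  in the domain.\<close>

lemma presburger_monoid_if_model:
  fixes M :: "('a, add_sym, unit) struct"
  defines "p \<equiv> \<lambda>x y. fun_of M Plus [x, y]"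
  assumes M: "is_model M PrA" and ne: "dom M \<noteq> {}"
    and closed: "\<And>x y. x \<in> dom M \<Longrightarrow> y \<in> dom M \<Longrightarrow> p x y \<in> dom M"
  shows "\<exists>z u. presburger_monoid (dom M) p z u"
proof -
  obtain c where "c \<in> dom M"
    using ne by blast
  \<comment> \<open>For a sentence any assignment into the domain will do.\<close>
  then have env: "range (\<lambda>_ :: nat. c) \<subseteq> dom M"
    by auto
  note sat = sat_if_model[OF M _ _ env]
  note sims = formula_in_def add_lang_def nat_add_def p_def insert_Diff_if
  have comm: "\<forall>x\<in>dom M. \<forall>y\<in>dom M. p x y = p y x"
    using sat[of "Forall 0 (Forall 1 (Defs.Eq (Plus_vars 0 1) (Plus_vars 1 0)))"]
    by (simp add: sims)
  have assoc: "\<forall>x\<in>dom M. \<forall>y\<in>dom M. \<forall>w\<in>dom M. p (p x y) w = p x (p y w)"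
    using sat[of "Forall 0 (Forall 1 (Forall 2 (Defs.Eq (App Plus [Plus_vars 0 1, Var 2])
      (App Plus [Var 0, Plus_vars 1 2]))))"]
    by (simp add: sims)
  have cancel: "\<forall>x\<in>dom M. \<forall>y\<in>dom M. \<forall>w\<in>dom M. p x y = p x w \<longrightarrow> y = w"
    using sat[of "Forall 0 (Forall 1 (Forall 2 (Implies (Defs.Eq (Plus_vars 0 1) (Plus_vars 0 2))
      (Defs.Eq (Var 1) (Var 2)))))"]
    by (simp add: sims)
  let ?linear = "Forall 0 (Forall 1 (Exists 2 (Implies
    (Defs.Neg (Defs.Eq (Plus_vars 0 2) (Var 1))) (Defs.Eq (Plus_vars 1 2) (Var 0)))))"
  have "sat M (\<lambda>_. c) ?linear"
  proof (rule sat)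
    show "sentence add_lang ?linear"
      by (simp add: sims)
    have "\<exists>w. x + w = y \<or> y + w = x" for x y :: nat
      by presburger
    then show "sat nat_add e ?linear" for e
      by (simp add: nat_add_def)
  qed
  then have linear: "\<forall>x\<in>dom M. \<forall>y\<in>dom M. \<exists>w\<in>dom M. p x w = y \<or> p y w = x"
    by (simp add: p_def)
  let ?zero = "Forall 1 (Defs.Eq (Plus_vars 1 0) (Var 1))"
  let ?zero_sum = "Forall 1 (Forall 2
    (Implies (Defs.Eq (Plus_vars 1 2) (Var 0)) (Defs.Eq (Var 1) (Var 0))))"
  let ?one = "Exists 3 (Conj (Defs.Neg (Defs.Eq (Var 3) (Var 0)))
    (Forall 1 (Implies (Defs.Neg (Defs.Eq (Var 1) (Var 0)))
      (Exists 2 (Defs.Eq (Var 1) (Plus_vars 2 3))))))"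
  \<comment> \<open>The language has no constants, so zero (variable 0) and one (variable 3) are
    introduced together by quantifiers in a single sentence.\<close>
  let ?const = "Exists 0 (Conj ?zero (Conj ?zero_sum ?one))"
  have "sat M (\<lambda>_. c) ?const"
  proof (rule sat)
    show "sentence add_lang ?const"
      by (simp add: sims)
    have "\<exists>u > (0::nat). \<forall>x. x = 0 \<or> (\<exists>y. x = y + u)"
      by presburger
    then show "sat nat_add e ?const" for e
      by (auto simp: nat_add_def)
  qed
  then have "\<exists>z\<in>dom M. (\<forall>x\<in>dom M. p x z = x) \<and>
      (\<forall>x\<in>dom M. \<forall>y\<in>dom M. p x y = z \<longrightarrow> x = z) \<and>
      (\<exists>u\<in>dom M. u \<noteq> z \<and> (\<forall>x\<in>dom M. x \<noteq> z \<longrightarrow> (\<exists>y\<in>dom M. x = p y u)))"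
    by (simp add: p_def) blast
  then obtain z u where
    "z \<in> dom M" "\<forall>x\<in>dom M. p x z = x" "\<forall>x\<in>dom M. \<forall>y\<in>dom M. p x y = z \<longrightarrow> x = z"
    "u \<in> dom M" "u \<noteq> z" "\<forall>x\<in>dom M. x \<noteq> z \<longrightarrow> (\<exists>y\<in>dom M. x = p y u)"
    by blast
  then have "presburger_monoid (dom M) p z u"
    using comm assoc cancel linear closed by unfold_locales blast+
  then show ?thesis
    by blast
qed

section \<open>The interpretation expressed by relations on numbers\<close>

locale presburger_interpretation =
  fixes \<iota> :: "(add_sym, unit, add_sym, unit) interp"
  assumes interp: "interpretation_in 1 add_lang add_lang nat_add \<iota>"
begin

definition model :: "(nat list set, add_sym, unit) struct" where
  "model = internal_model 1 nat_add \<iota>"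

text \<open>In dimension one all tuples are singleton lists, so the interpretation can be handled
  through plain numbers.\<close>

definition D :: "nat set" where
  "D = {x. [x] \<in> int_dom 1 nat_add \<iota>}"

definition eqv :: "nat \<Rightarrow> nat \<Rightarrow> bool" where
  "eqv x y \<longleftrightarrow> ([x], [y]) \<in> int_eq 1 nat_add \<iota>"

definition cls :: "nat \<Rightarrow> nat list set" where
  "cls x = int_eq 1 nat_add \<iota> `` {[x]}"

definition plus :: "nat \<Rightarrow> nat \<Rightarrow> nat \<Rightarrow> bool" where
  "plus x y w \<longleftrightarrow> sat_at nat_add [x, y, w] (fun_fm \<iota> Plus)"

lemma equiv_int_eq: "equiv (int_dom 1 nat_add \<iota>) (int_eq 1 nat_add \<iota>)"
  using interp unfolding interpretation_in_def by blast

lemma int_dom_conv: "int_dom 1 nat_add \<iota> = (\<lambda>x. [x]) ` D"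
  by (auto simp: D_def int_dom_def length_Suc_conv)

lemma dom_model: "dom model = cls ` D"
  unfolding model_def internal_model_def cls_def quotient_def int_dom_conv by auto

lemma cls_eq_iff: "x \<in> D \<Longrightarrow> y \<in> D \<Longrightarrow> cls x = cls y \<longleftrightarrow> eqv x y"
  unfolding cls_def eqv_def D_def mem_Collect_eq by (rule eq_equiv_class_iff[OF equiv_int_eq])

lemma eqv_in_D: "eqv x y \<Longrightarrow> x \<in> D \<and> y \<in> D"
  unfolding eqv_def D_def int_eq_def by simp

lemma mem_cls_iff: "v \<in> cls x \<longleftrightarrow> (\<exists>y. v = [y] \<and> eqv x y)"
  unfolding cls_def eqv_def
  by (auto simp: int_eq_def int_dom_def length_Suc_conv)

lemma plus_total: "x \<in> D \<Longrightarrow> y \<in> D \<Longrightarrow> \<exists>w\<in>D. plus x y w"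
proof -
  assume xy: "x \<in> D" "y \<in> D"
  have "\<forall>xs. length xs = 2 \<longrightarrow> set xs \<subseteq> int_dom 1 nat_add \<iota> \<longrightarrow>
      (\<exists>y\<in>int_dom 1 nat_add \<iota>. sat_at nat_add (concat xs @ y) (fun_fm \<iota> Plus))"
    using interp unfolding interpretation_in_def add_lang_def by simp
  from this[rule_format, of "[[x], [y]]"] show ?thesis
    using xy unfolding int_dom_conv plus_def by auto
qed

lemma plus_unique:
  assumes "eqv x x'" "eqv y y'" "w \<in> D" "w' \<in> D" "plus x y w" "plus x' y' w'"
  shows "eqv w w'"
proof -
  have "\<forall>xs xs'. length xs = 2 \<longrightarrow> list_all2 (\<lambda>x x'. (x, x') \<in> int_eq 1 nat_add \<iota>) xs xs' \<longrightarrow>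
      (\<forall>y\<in>int_dom 1 nat_add \<iota>. \<forall>y'\<in>int_dom 1 nat_add \<iota>.
         sat_at nat_add (concat xs @ y) (fun_fm \<iota> Plus) \<longrightarrow>
         sat_at nat_add (concat xs' @ y') (fun_fm \<iota> Plus) \<longrightarrow> (y, y') \<in> int_eq 1 nat_add \<iota>)"
    using interp unfolding interpretation_in_def add_lang_def by simp
  from this[rule_format, of "[[x], [y]]" "[[x'], [y']]" "[w]" "[w']"] show ?thesis
    using assms unfolding eqv_def D_def plus_def by simp
qed

text \<open>Any choice of representatives yields an equivalent value by \<open>plus_unique\<close>,
  so the definite description in \<open>internal_model\<close> picks out the class of
  \<open>w\<close>.\<close>

lemma fun_of_model:
  assumes "x \<in> D" "y \<in> D" "w \<in> D" "plus x y w"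
  shows "fun_of model Plus [cls x, cls y] = cls w"
proof -
  have refl: "eqv x x" "eqv y y" "eqv w w"
    using assms cls_eq_iff by blast+
  have "(THE Y. Y \<in> dom model \<and> (\<exists>xs v. list_all2 (\<in>) xs [cls x, cls y] \<and> v \<in> Y \<and>
      sat_at nat_add (concat xs @ v) (fun_fm \<iota> Plus))) = cls w"
  proof (rule the_equality)
    have "list_all2 (\<in>) [[x], [y]] [cls x, cls y]" "[w] \<in> cls w"
      using refl by (simp_all add: mem_cls_iff)
    moreover have "sat_at nat_add (concat [[x], [y]] @ [w]) (fun_fm \<iota> Plus)"
      using assms by (simp add: plus_def)
    ultimately show "cls w \<in> dom model \<and> (\<exists>xs v. list_all2 (\<in>) xs [cls x, cls y] \<and> v \<in> cls w \<and>
        sat_at nat_add (concat xs @ v) (fun_fm \<iota> Plus))"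
      using assms(3) unfolding dom_model by blast
  next
    fix Y
    assume Y: "Y \<in> dom model \<and> (\<exists>xs v. list_all2 (\<in>) xs [cls x, cls y] \<and> v \<in> Y \<and>
        sat_at nat_add (concat xs @ v) (fun_fm \<iota> Plus))"
    then obtain w' xs v where w': "w' \<in> D" "Y = cls w'" and
      xs: "list_all2 (\<in>) xs [cls x, cls y]" "v \<in> Y" "sat_at nat_add (concat xs @ v) (fun_fm \<iota> Plus)"
      unfolding dom_model by blast
    from xs(1) obtain a b where "xs = [a, b]" "a \<in> cls x" "b \<in> cls y"
      by (auto simp: list_all2_Cons2)
    then obtain a' b' c where abc: "xs = [[a'], [b']]" "eqv x a'" "eqv y b'" "v = [c]" "eqv w' c"
      using xs(2) w' by (auto simp: mem_cls_iff)
    then have "eqv w c"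
      using plus_unique[of x a' y b' w c] assms xs(3) eqv_in_D by (auto simp: plus_def)
    then show "Y = cls w"
      using w' abc cls_eq_iff eqv_in_D by metis
  qed
  then show ?thesis
    unfolding model_def internal_model_def by simp
qed

definition rep :: "nat list set \<Rightarrow> nat" where
  "rep X = (LEAST y. [y] \<in> X)"

text \<open>The values of \<open>rep\<close> on classes, described by \<open>D\<close> and
  \<open>eqv\<close> alone so that definability is immediate.\<close>

definition least_rep :: "nat \<Rightarrow> bool" where
  "least_rep y \<longleftrightarrow> y \<in> D \<and> (\<forall>v. v < y \<longrightarrow> \<not> eqv v y)"

text \<open>Only least representatives are admitted below \<open>x\<close>, so that the number of \<open>y\<close> with \<open>below x y\<close>
  is the position of the class of \<open>x\<close> in the internal model.\<close>

definition below :: "nat \<Rightarrow> nat \<Rightarrow> bool" where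
  "below x y \<longleftrightarrow> x \<in> D \<and> least_rep y \<and> \<not> eqv y x \<and> (\<exists>w x'. w \<in> D \<and> plus y w x' \<and> eqv x' x)"

lemma eqv_rep:
  assumes "x \<in> D"
  shows "eqv x (rep (cls x))"
proof -
  have "[x] \<in> cls x"
    using assms cls_eq_iff by (auto simp: mem_cls_iff)
  then have "[rep (cls x)] \<in> cls x"
    unfolding rep_def by (rule LeastI)
  then show ?thesis
    by (simp add: mem_cls_iff)
qed

lemma cls_rep: "x \<in> D \<Longrightarrow> cls (rep (cls x)) = cls x"
  using eqv_rep eqv_in_D cls_eq_iff by metis

lemma inj_on_rep: "inj_on rep (dom model)"
  unfolding dom_model by (rule inj_onI) (metis cls_rep imageE)

lemma least_rep_iff: "least_rep y \<longleftrightarrow> y \<in> D \<and> rep (cls y) = y"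
proof
  assume y: "least_rep y"
  then have "y \<in> D" and "\<not> rep (cls y) < y"
    using eqv_rep cls_eq_iff eqv_in_D unfolding least_rep_def by metis+
  moreover have "rep (cls y) \<le> y"
    unfolding rep_def using \<open>y \<in> D\<close> cls_eq_iff by (intro Least_le) (auto simp: mem_cls_iff)
  ultimately show "y \<in> D \<and> rep (cls y) = y"
    by simp
next
  assume y: "y \<in> D \<and> rep (cls y) = y"
  have "\<not> eqv v y" if "v < y" for v
  proof
    assume v: "eqv v y"
    then have "[v] \<in> cls y"
      using eqv_in_D cls_eq_iff mem_cls_iff by metis
    then have "rep (cls y) \<le> v"
      unfolding rep_def by (rule Least_le)
    then show False
      using y that by simp
  qed
  then show "least_rep y"
    using y unfolding least_rep_def by blast
qed

text \<open>Links the definable relation, to which tameness applies, with the algebra: the set on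
  the right is the coded \<open>seg (cls x)\<close>, written out before the monoid structure is
  available.\<close>

lemma below_iff:
  assumes x: "x \<in> D"
  shows "{y. below x y} = rep ` {Y \<in> dom model. Y \<noteq> cls x \<and>
    (\<exists>W\<in>dom model. fun_of model Plus [Y, W] = cls x)}" (is "_ = rep ` ?S")
proof (rule set_eqI, rule iffI)
  fix y
  assume "y \<in> {y. below x y}"
  then obtain w x' where y: "y \<in> D" "rep (cls y) = y" "\<not> eqv y x"
      and w: "w \<in> D" "plus y w x'" "eqv x' x"
    by (auto simp: below_def least_rep_iff)
  have "fun_of model Plus [cls y, cls w] = cls x"
    using fun_of_model[of y w x'] y w x cls_eq_iff eqv_in_D by metis
  then have "cls y \<in> ?S"
    using y w x by (auto simp: dom_model cls_eq_iff)
  then have "rep (cls y) \<in> rep ` ?S"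
    by (rule imageI)
  then show "y \<in> rep ` ?S"
    unfolding y(2) .
next
  fix y
  assume "y \<in> rep ` ?S"
  then obtain v w where v: "v \<in> D" "y = rep (cls v)" "cls v \<noteq> cls x"
      and w: "w \<in> D" "fun_of model Plus [cls v, cls w] = cls x"
    by (auto simp: dom_model)
  have y: "y \<in> D" "cls y = cls v" "rep (cls y) = y"
    using v cls_rep eqv_rep eqv_in_D by metis+
  obtain x' where x': "x' \<in> D" "plus y w x'"
    using plus_total y w by blast
  have "eqv x' x"
    using fun_of_model[of y w x'] cls_eq_iff[of x' x] x x' y w by simp
  moreover have "\<not> eqv y x"
    using cls_eq_iff[of y x] x y v by simp
  ultimately show "y \<in> {y. below x y}"
    unfolding below_def least_rep_iff using x y w x' by blast
qed

section \<open>Definability of the coded order and of the isomorphism\<close>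

lemma definable_D: "definable (\<lambda>e. e i \<in> D)"
proof -
  have "formula_in add_lang 1 (dom_fm \<iota>)"
    using interp unfolding interpretation_in_def by blast
  from definable_formula[OF this, of "[i]"] show ?thesis
    by (simp add: D_def int_dom_def nat_add_def)
qed

lemma definable_eqv: "definable (\<lambda>e. eqv (e i) (e j))"
proof -
  have "formula_in add_lang 2 (eq_fm \<iota>)"
    using interp unfolding interpretation_in_def by simp
  from definable_formula[OF this, of "[i, j]"] have "definable (\<lambda>e. sat_at nat_add [e i, e j] (eq_fm \<iota>))"
    by simp
  with definable_D[of i] definable_D[of j]
  have "definable (\<lambda>e. e i \<in> D \<and> e j \<in> D \<and> sat_at nat_add [e i, e j] (eq_fm \<iota>))"
    by (intro definable_conj)
  then show ?thesis
    by (simp add: eqv_def int_eq_def D_def)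
qed

lemma definable_plus: "definable (\<lambda>e. plus (e i) (e j) (e k))"
proof -
  have "formula_in add_lang 3 (fun_fm \<iota> Plus)"
    using interp unfolding interpretation_in_def add_lang_def by (simp add: numeral_eq_Suc)
  from definable_formula[OF this, of "[i, j, k]"] show ?thesis
    by (simp add: plus_def)
qed

lemma definable_below: "definable (\<lambda>e. below (e i) (e j))"
  unfolding below_def least_rep_def
  by (intro definable_conj definable_not definable_all definable_imp definable_ex definable_less
      definable_fun_var definable_D definable_eqv definable_plus)

lemma defines_isomorphism_if_model:
  assumes "is_model model PrA"
  obtains F where "defines_isomorphism 1 add_lang nat_add \<iota> F"
proof -
  define p where "p X Y = fun_of model Plus [X, Y]" for X Y
  have "D \<noteq> {}"
    using interp unfolding interpretation_in_def int_dom_conv by blast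
  then have "dom model \<noteq> {}"
    unfolding dom_model by blast
  moreover have closed: "p X Y \<in> dom model" if "X \<in> dom model" "Y \<in> dom model" for X Y
  proof -
    obtain x y where xy: "x \<in> D" "y \<in> D" "X = cls x" "Y = cls y"
      using \<open>X \<in> dom model\<close> \<open>Y \<in> dom model\<close> unfolding dom_model by blast
    then obtain w where "w \<in> D" "plus x y w"
      using plus_total by blast
    then show ?thesis
      using xy fun_of_model unfolding p_def dom_model by auto
  qed
  ultimately obtain z u where "presburger_monoid (dom model) p z u"
    using presburger_monoid_if_model[OF assms] unfolding p_def by blast
  then interpret pm: presburger_monoid "dom model" p z u .
  have below_seg: "{y. below x y} = rep ` pm.seg (cls x)" if "x \<in> D" for x
    unfolding pm.seg_def p_def using that by (rule below_iff)
  have tame: "tame below"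
    by (rule tame_if_definable) (rule definable_below)
  \<comment> \<open>One period serves all fibres, hence all initial segments at once.\<close>
  then obtain N where N: "N > 0" "finite {y. below x y \<noteq> below x (y + N)}" for x
    unfolding tame_def by blast
  have fin: "finite (pm.seg X)" if X: "X \<in> dom model" for X
  proof (rule pm.finite_seg_if_eventually_periodic[OF inj_on_rep N(1) _ X])
    fix X
    assume "X \<in> dom model"
    then obtain x where x: "x \<in> D" "X = cls x"
      unfolding dom_model by blast
    have "y \<in> rep ` pm.seg X \<longleftrightarrow> below x y" for y
      using below_seg x by blast
    then show "finite {y. (y \<in> rep ` pm.seg X) \<noteq> (y + N \<in> rep ` pm.seg X)}"
      using N(2)[of x] by simp
  qed
  define h where "h X = card (pm.seg X)" for X
  have card_below: "card {y. below x y} = h (cls x)" if "x \<in> D" for x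
    unfolding h_def below_seg[OF that]
    using inj_on_rep pm.seg_subset by (meson card_image inj_on_subset)
  \<comment> \<open>\<open>definable_card_eq\<close> asks for finiteness at every number; outside
    \<open>D\<close> the fibre is empty.\<close>
  have "finite {y. below x y}" for x
  proof (cases "x \<in> D")
    case True
    then have "finite (pm.seg (cls x))"
      using fin dom_model by blast
    then show ?thesis
      unfolding below_seg[OF True] by (rule finite_imageI)
  qed (simp add: below_def)
  then have "definable (\<lambda>e. e (Suc 0) = card {y. below (e 0) y})"
    by (intro definable_card_eq tame definable_below)
  \<comment> \<open>Without the condition on \<open>D\<close> the formula would also hold at pairs
    \<open>x\<close>, 0 with \<open>x\<close> outside the domain.\<close>
  then have "definable (\<lambda>e. e 0 \<in> D \<and> e (Suc 0) = card {y. below (e 0) y})"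
    by (intro definable_conj definable_D)
  then obtain F where F: "formula_in add_lang 2 F"
      "\<And>x y. sat_at nat_add [x, y] F \<longleftrightarrow> x \<in> D \<and> y = card {y. below x y}"
    by (rule formula_if_definable[where R = "\<lambda>x y. x \<in> D \<and> y = card {y. below x y}"]) blast
  have "isomorphism add_lang model nat_add h"
    unfolding isomorphism_def
  proof (intro conjI allI impI)
    show "bij_betw h (dom model) (dom nat_add)"
      using pm.bij_betw_card_seg[OF fin] by (simp add: h_def[abs_def] nat_add_def)
  next
    fix f n and Xs :: "nat list set list"
    assume n: "fun_arity add_lang f = Some n" "length Xs = n" "set Xs \<subseteq> dom model"
    have f: "f = Plus"
      by (cases f)
    obtain X Y where Xs: "Xs = [X, Y]"
      using n by (auto simp: add_lang_def length_Suc_conv numeral_2_eq_2)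
    have "h (p X Y) = h X + h Y"
      unfolding h_def using n Xs by (intro pm.card_seg_add fin) auto
    then show "h (fun_of model f Xs) = fun_of nat_add f (map h Xs)"
      unfolding f Xs p_def by (simp add: nat_add_def)
  next
    fix q n and Xs :: "nat list set list"
    assume "pred_arity add_lang q = Some n"
    then show "pred_of model q Xs \<longleftrightarrow> pred_of nat_add q (map h Xs)"
      by (simp add: add_lang_def)
  qed
  moreover have "sat_at nat_add (v @ [y]) F \<longleftrightarrow>
      v \<in> int_dom 1 nat_add \<iota> \<and> h (int_eq 1 nat_add \<iota> `` {v}) = y" if v: "length v = 1" for v y
  proof -
    obtain x where x: "v = [x]"
      using v by (auto simp: length_Suc_conv)
    show ?thesis
      using card_below unfolding x by (auto simp: F(2) D_def cls_def)
  qed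
  ultimately have "defines_isomorphism 1 add_lang nat_add \<iota> F"
    unfolding defines_isomorphism_def model_def using F(1) by (auto simp: numeral_2_eq_2)
  then show thesis
    by (rule that)
qed

end

theorem theorem1p1:
  fixes \<iota> :: "(add_sym, unit, add_sym, unit) interp"
    and \<AA> :: "(nat list set, add_sym, unit) struct"
  assumes "interpretation_in 1 add_lang add_lang nat_add \<iota>"
    and "\<AA> = internal_model 1 nat_add \<iota>"
    and "is_model \<AA> PrA"
  shows "isomorphic add_lang \<AA> nat_add \<and>
    (\<exists>F. defines_isomorphism 1 add_lang nat_add \<iota> F)"
proof -
  interpret presburger_interpretation \<iota>
    by unfold_locales (rule assms(1))
  obtain F where "defines_isomorphism 1 add_lang nat_add \<iota> F"
    using defines_isomorphism_if_model assms(2,3) unfolding model_def by blast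
  then show ?thesis
    unfolding isomorphic_def assms(2) defines_isomorphism_def by blast
qed

end
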